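(* The Hilbert series of the coordinate ring of the cone of ${\mathrm{Sp}}(4)$ is \[\mathrm{H}(\mathcal{O}(\mathcal{C}({\mathrm{Sp}}(4)));t)=\frac{1+5t+5t^2+t^3}{(1-t)^{11}}.\]
   Context: ${\mathrm{Sp}}(4)=\{M\in\mathbb{C}^{4\times4}\mid M^TJM=J\}$ where $J$ is block diagonal with two blocks $\begin{pmatrix}0&1\\-1&0\end{pmatrix}$. The cone $\mathcal{C}({\mathrm{Sp}}(4))$ is the Zariski closure in $\mathbb{C}^{4\times 4}$ of $\{cM\mid c\in\mathbb{C},M\in{\mathrm{Sp}}(4)\}$; its coordinate ring is the quotient of the standard graded polynomial ring $\mathbb{C}[x_{ij}\mid 1\le i,j\le 4]$ by the homogeneous vanishing ideal, with the induced grading. The Hilbert series of a graded algebra $A=\bigoplus_dA_d$ is $\sum_d\dim_{\mathbb{C}}(A_d)t^d$. *)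

theory Defs
  imports "HOL-Analysis.Analysis" "HOL-Library.Poly_Mapping"
    "HOL-Computational_Algebra.Formal_Power_Series"
begin

text \<open>4x4 complex matrices are indexed by the 4-element type 4 (elements 1,2,3,4, where 4 = 0).\<close>

definition symJ :: "complex^4^4" where
  "symJ = (\<chi> i j. if (i = 1 \<and> j = 2) \<or> (i = 3 \<and> j = 4) then 1
                 else if (i = 2 \<and> j = 1) \<or> (i = 4 \<and> j = 3) then -1 else 0)"

definition Sp4 :: "(complex^4^4) set" where
  "Sp4 = {M. transpose M ** symJ ** M = symJ}"

definition cone_set :: "(complex^4^4) set \<Rightarrow> (complex^4^4) set" where
  "cone_set S = {(\<chi> i j. c * M $ i $ j) | c M. M \<in> S}"

type_synonym mpoly16 = "((4 \<times> 4) \<Rightarrow>\<^sub>0 nat) \<Rightarrow>\<^sub>0 complex"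

definition mon_eval :: "((4 \<times> 4) \<Rightarrow>\<^sub>0 nat) \<Rightarrow> complex^4^4 \<Rightarrow> complex" where
  "mon_eval m M = (\<Prod>v\<in>UNIV. (M $ fst v $ snd v) ^ Poly_Mapping.lookup m v)"

definition peval :: "mpoly16 \<Rightarrow> complex^4^4 \<Rightarrow> complex" where
  "peval p M = (\<Sum>m\<in>Poly_Mapping.keys p. Poly_Mapping.lookup p m * mon_eval m M)"

definition mon_deg :: "((4 \<times> 4) \<Rightarrow>\<^sub>0 nat) \<Rightarrow> nat" where
  "mon_deg m = (\<Sum>v\<in>UNIV. Poly_Mapping.lookup m v)"

definition pscale :: "complex \<Rightarrow> mpoly16 \<Rightarrow> mpoly16" where
  "pscale c p = Poly_Mapping.map (\<lambda>a. c * a) p"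

definition hom_polys :: "nat \<Rightarrow> mpoly16 set" where
  "hom_polys d = {p. \<forall>m\<in>Poly_Mapping.keys p. mon_deg m = d}"

definition zariski_closure :: "(complex^4^4) set \<Rightarrow> (complex^4^4) set" where
  "zariski_closure S = {x. \<forall>p. (\<forall>y\<in>S. peval p y = 0) \<longrightarrow> peval p x = 0}"

definition vanishing_ideal :: "(complex^4^4) set \<Rightarrow> mpoly16 set" where
  "vanishing_ideal V = {p. \<forall>x\<in>V. peval p x = 0}"

text \<open>Dimension of the degree-d component of the coordinate ring C[x]/I(V) for a
  cone V (homogeneous ideal): A_d = C[x]_d / (I(V) \<inter> C[x]_d).\<close>
definition coord_ring_dim :: "(complex^4^4) set \<Rightarrow> nat \<Rightarrow> nat" where
  "coord_ring_dim V d =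
     vector_space.dim pscale (hom_polys d) - vector_space.dim pscale (hom_polys d \<inter> vanishing_ideal V)"

definition hilbert_series :: "(complex^4^4) set \<Rightarrow> rat fps" where
  "hilbert_series V = Abs_fps (\<lambda>d. of_nat (coord_ring_dim V d))"

end

theory Submission
  imports Defs
begin

text \<open>The matrix entries are the weight vectors of the 16-dimensional half-spin representation of \<open>Spin(10)\<close>,
  and the cone of \<open>Sp(4)\<close> is the cone over the spinor variety, cut out by ten quadrics. Ordering the weights
  by inclusion of shifted Young diagrams gives a distributive lattice with exactly ten incomparable pairs, and
  each quadric rewrites the product of one such pair. Hence the monomials supported on chains of the
  lattice span each graded piece of the coordinate ring. They are also linearly independent: on a suitable
  curve \<open>z \<mapsto> M(z)\<close> in the cone, the entry at \<open>v\<close> vanishes at 0 to order \<open>\<Sum>k\<in>boxes v. B ^ k\<close>, and for large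
  \<open>B\<close> the vanishing order of a chain monomial of degree \<open>d\<close> determines the monomial. Counting
  chain monomials by their largest element gives a triangular linear system for the generating functions.\<close>

section \<open>Chain monomials\<close>

text \<open>The indices \<open>w\<close> of nonzero multiplicity with \<open>J v\<close> not inside
  \<open>J w\<close> form a chain \<open>T\<close>. If \<open>T\<close> met every \<open>k\<close>
  in \<open>J v\<close>, its largest set would contain all of \<open>J v\<close>. So some
  \<open>k\<close> in \<open>J v\<close> is missed by all of \<open>T\<close>, and for this
  \<open>k\<close> both sums have the same nonzero terms.\<close>

lemma chain_sum_eq_some:
  fixes J :: "'a::finite \<Rightarrow> 'b set" and m :: "'a \<Rightarrow> nat"
  assumes chain: "\<And>v w. m v \<noteq> 0 \<Longrightarrow> m w \<noteq> 0 \<Longrightarrow> J v \<subseteq> J w \<or> J w \<subseteq> J v"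
    and ne: "J v \<noteq> {}"
  shows "\<exists>k\<in>J v. (\<Sum>w | J v \<subseteq> J w. m w) = (\<Sum>w | k \<in> J w. m w)"
proof (rule ccontr)
  assume "\<not> ?thesis"
  then have neq: "(\<Sum>w | J v \<subseteq> J w. m w) \<noteq> (\<Sum>w | k \<in> J w. m w)" if "k \<in> J v" for k
    using that by blast
  define T where "T = {w. m w \<noteq> 0 \<and> \<not> J v \<subseteq> J w}"
  have wit: "\<exists>w\<in>T. k \<in> J w" if k: "k \<in> J v" for k
  proof (rule ccontr)
    assume "\<not> (\<exists>w\<in>T. k \<in> J w)"
    then have "(\<Sum>w | J v \<subseteq> J w. m w) = (\<Sum>w | k \<in> J w. m w)"
      using k by (intro sum.mono_neutral_left) (simp_all add: T_def, blast+)
    then show False using neq[OF k] by blast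
  qed
  have "\<exists>w\<in>T. \<forall>u\<in>T. J u \<subseteq> J w"
  proof -
    have "J ` T \<noteq> {}" using wit ne by blast
    then obtain X where X: "X \<in> J ` T" "\<And>Y. Y \<in> J ` T \<Longrightarrow> X \<subseteq> Y \<Longrightarrow> X = Y"
      using finite_has_maximal[of "J ` T"] by auto
    then obtain w where w: "w \<in> T" "X = J w" by blast
    have "J u \<subseteq> J w" if "u \<in> T" for u
      using chain[of u w] w X(2)[of "J u"] that unfolding T_def by blast
    then show ?thesis using w by blast
  qed
  then obtain w where w: "w \<in> T" "\<forall>u\<in>T. J u \<subseteq> J w" by blast
  then have "J v \<subseteq> J w" using wit by blast
  then show False using w(1) by (simp add: T_def)
qed

text \<open>For nonempty \<open>J v\<close>, the multiplicity above \<open>v\<close> is the minimum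
  over \<open>k\<close> in \<open>J v\<close> of the sums in \<open>eq\<close>: it is a lower bound
  for them, and \<open>chain_sum_eq_some\<close> shows that it is attained. For empty
  \<open>J v\<close> it is the degree. Descending induction along inclusion then isolates the
  multiplicity at \<open>v\<close> itself.\<close>

lemma chain_eqI:
  fixes J :: "'a::finite \<Rightarrow> 'b set" and m n :: "'a \<Rightarrow> nat"
  assumes inj: "inj J"
    and cm: "\<And>v w. m v \<noteq> 0 \<Longrightarrow> m w \<noteq> 0 \<Longrightarrow> J v \<subseteq> J w \<or> J w \<subseteq> J v"
    and cn: "\<And>v w. n v \<noteq> 0 \<Longrightarrow> n w \<noteq> 0 \<Longrightarrow> J v \<subseteq> J w \<or> J w \<subseteq> J v"
    and deg: "sum m UNIV = sum n UNIV"
    and eq: "\<And>k. (\<Sum>w | k \<in> J w. m w) = (\<Sum>w | k \<in> J w. n w)"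
  shows "m = n"
proof -
  have le: "(\<Sum>w | J v \<subseteq> J w. f w) \<le> (\<Sum>w | k \<in> J w. f w)" if "k \<in> J v" for k v and f :: "'a \<Rightarrow> nat"
    using that by (intro sum_mono2) auto
  have N: "(\<Sum>w | J v \<subseteq> J w. m w) = (\<Sum>w | J v \<subseteq> J w. n w)" for v
  proof (cases "J v = {}")
    case True
    then show ?thesis using deg by simp
  next
    case False
    obtain k l where "k \<in> J v" "(\<Sum>w | J v \<subseteq> J w. m w) = (\<Sum>w | k \<in> J w. m w)"
      and "l \<in> J v" "(\<Sum>w | J v \<subseteq> J w. n w) = (\<Sum>w | l \<in> J w. n w)"
      using chain_sum_eq_some[of m J v, OF cm False] chain_sum_eq_some[of n J v, OF cn False] by blast
    then show ?thesis
      using le[of k v n] le[of l v m] eq[of k] eq[of l] by simp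
  qed
  have "m v = n v" for v
  proof (induction "card {w. J v \<subset> J w}" arbitrary: v rule: less_induct)
    case less
    have IH: "m w = n w" if "J v \<subset> J w" for w
    proof (rule less)
      show "card {u. J w \<subset> J u} < card {u. J v \<subset> J u}"
        by (rule psubset_card_mono) (use that in auto)
    qed
    have S: "{w. J v \<subseteq> J w} = insert v {w. J v \<subset> J w}"
      using inj by (auto dest: injD)
    have "sum f {w. J v \<subseteq> J w} = f v + sum f {w. J v \<subset> J w}" for f :: "'a \<Rightarrow> nat"
      unfolding S by (subst sum.insert) auto
    moreover have "sum m {w. J v \<subset> J w} = sum n {w. J v \<subset> J w}"
      using IH by (intro sum.cong) auto
    ultimately show ?case using N[of v] by simp
  qed
  then show ?thesis by blast
qed

lemma digits_unique:
  fixes e f :: "nat \<Rightarrow> nat"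
  assumes "\<And>k. k < n \<Longrightarrow> e k < B" "\<And>k. k < n \<Longrightarrow> f k < B"
    and "(\<Sum>k<n. e k * B ^ k) = (\<Sum>k<n. f k * B ^ k)" "k < n"
  shows "e k = f k"
  using assms
proof (induction n arbitrary: e f k)
  case 0
  then show ?case by simp
next
  case (Suc n)
  have split: "(\<Sum>k<Suc n. g k * B ^ k) = g 0 + B * (\<Sum>k<n. g (Suc k) * B ^ k)" for g :: "nat \<Rightarrow> nat"
    by (subst sum.lessThan_Suc_shift) (simp add: sum_distrib_left algebra_simps)
  have eq: "e 0 + B * (\<Sum>k<n. e (Suc k) * B ^ k) = f 0 + B * (\<Sum>k<n. f (Suc k) * B ^ k)"
    using Suc.prems(3) by (simp only: split)
  have lt: "e 0 < B" "f 0 < B" using Suc.prems by auto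
  have e0: "e 0 = f 0"
    using arg_cong[OF eq, of "\<lambda>x. x mod B"] lt by simp
  moreover have "(\<Sum>k<n. e (Suc k) * B ^ k) = (\<Sum>k<n. f (Suc k) * B ^ k)"
    using eq e0 lt by simp
  then have "e (Suc j) = f (Suc j)" if "j < n" for j
    using Suc.IH[of "\<lambda>k. e (Suc k)" "\<lambda>k. f (Suc k)" j] Suc.prems that by simp
  ultimately show ?case using Suc.prems(4) by (cases k) auto
qed

section \<open>Counting chain monomials by degree and largest element\<close>

text \<open>The analogue of \<open>mon_deg\<close> for any finite set of variables, so that the
  counting below works for an arbitrary family of sets \<open>J\<close>.\<close>

definition mdeg :: "('a::finite \<Rightarrow>\<^sub>0 nat) \<Rightarrow> nat" where
  "mdeg m = (\<Sum>v\<in>UNIV. Poly_Mapping.lookup m v)"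

lemma mdeg_add: "mdeg (m + n) = mdeg m + mdeg n"
  by (simp add: mdeg_def lookup_add sum.distrib)

lemma mdeg_single [simp]: "mdeg (Poly_Mapping.single v k) = k"
  by (simp add: mdeg_def lookup_single when_def)

definition chain_monos :: "('a::finite \<Rightarrow> 'b set) \<Rightarrow> nat \<Rightarrow> ('a \<Rightarrow>\<^sub>0 nat) set" where
  "chain_monos J d = {m. mdeg m = d \<and> (\<forall>v\<in>Poly_Mapping.keys m. \<forall>w\<in>Poly_Mapping.keys m. J v \<subseteq> J w \<or> J w \<subseteq> J v)}"

lemma chain_monosD:
  assumes "m \<in> chain_monos J d" "Poly_Mapping.lookup m v \<noteq> 0" "Poly_Mapping.lookup m w \<noteq> 0"
  shows "J v \<subseteq> J w \<or> J w \<subseteq> J v"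
  using assms by (simp add: chain_monos_def in_keys_iff)

definition chain_monos_below :: "('a::finite \<Rightarrow> 'b set) \<Rightarrow> 'a \<Rightarrow> nat \<Rightarrow> ('a \<Rightarrow>\<^sub>0 nat) set" where
  "chain_monos_below J a d = {m \<in> chain_monos J d. \<forall>v\<in>Poly_Mapping.keys m. J v \<subseteq> J a}"

lemma mdeg_eq_0_iff: "mdeg m = 0 \<longleftrightarrow> m = 0"
  by (simp add: mdeg_def poly_mapping_eq_iff fun_eq_iff)

lemma chain_monos_below_0: "chain_monos_below J a 0 = {0}"
  by (auto simp: chain_monos_below_def chain_monos_def mdeg_eq_0_iff)

lemma keys_add_nat: "Poly_Mapping.keys (m + n :: 'a \<Rightarrow>\<^sub>0 nat) = Poly_Mapping.keys m \<union> Poly_Mapping.keys n"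
  by (auto simp: in_keys_iff lookup_add)

lemma diff_single_add:
  fixes m :: "'a \<Rightarrow>\<^sub>0 nat"
  assumes "v \<in> Poly_Mapping.keys m"
  shows "m = (m - Poly_Mapping.single v 1) + Poly_Mapping.single v 1"
  using assms by (intro poly_mapping_eqI) (auto simp: lookup_add lookup_minus lookup_single when_def in_keys_iff)

text \<open>Removing one factor at the largest element \<open>b\<close> of the support leaves a
  chain monomial below \<open>b\<close>, in which \<open>b\<close> may occur again.\<close>

lemma chain_monos_below_Suc:
  "chain_monos_below J a (Suc d) =
     (\<Union>b\<in>{b. J b \<subseteq> J a}. (\<lambda>m. m + Poly_Mapping.single b 1) ` chain_monos_below J b d)"
proof (intro equalityI subsetI)
  fix m assume m: "m \<in> chain_monos_below J a (Suc d)"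
  then have "m \<noteq> 0" by (auto simp: chain_monos_below_def chain_monos_def mdeg_def)
  then have "J ` Poly_Mapping.keys m \<noteq> {}" by auto
  then obtain X where X: "X \<in> J ` Poly_Mapping.keys m"
      "\<And>Y. Y \<in> J ` Poly_Mapping.keys m \<Longrightarrow> X \<subseteq> Y \<Longrightarrow> X = Y"
    using finite_has_maximal[of "J ` Poly_Mapping.keys m"] by auto
  then obtain b where b: "b \<in> Poly_Mapping.keys m" "X = J b" by blast
  have top: "J v \<subseteq> J b" if "v \<in> Poly_Mapping.keys m" for v
    using m b X(2)[of "J v"] that unfolding chain_monos_below_def chain_monos_def by blast
  define n where "n = m - Poly_Mapping.single b 1"
  have mn: "m = n + Poly_Mapping.single b 1" unfolding n_def by (rule diff_single_add[OF b(1)])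
  have "Poly_Mapping.keys n \<subseteq> Poly_Mapping.keys m" unfolding mn keys_add_nat by blast
  moreover have "mdeg n = d" using m mn by (simp add: chain_monos_below_def chain_monos_def mdeg_add)
  ultimately have "n \<in> chain_monos_below J b d"
    using m top unfolding chain_monos_below_def chain_monos_def by blast
  moreover have "J b \<subseteq> J a" using m b by (auto simp: chain_monos_below_def)
  ultimately show "m \<in> (\<Union>b\<in>{b. J b \<subseteq> J a}. (\<lambda>m. m + Poly_Mapping.single b 1) ` chain_monos_below J b d)"
    using mn by blast
next
  fix m assume "m \<in> (\<Union>b\<in>{b. J b \<subseteq> J a}. (\<lambda>m. m + Poly_Mapping.single b 1) ` chain_monos_below J b d)"
  then obtain b n where "J b \<subseteq> J a" "n \<in> chain_monos_below J b d" "m = n + Poly_Mapping.single b 1"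
    by blast
  then show "m \<in> chain_monos_below J a (Suc d)"
    by (auto simp: chain_monos_below_def chain_monos_def mdeg_add keys_add_nat subset_iff)
qed

lemma finite_chain_monos_below: "finite (chain_monos_below J a d)"
  by (induction d arbitrary: a) (simp_all add: chain_monos_below_0 chain_monos_below_Suc)

lemma card_chain_monos_below_Suc:
  assumes "inj J"
  shows "card (chain_monos_below J a (Suc d)) = (\<Sum>b | J b \<subseteq> J a. card (chain_monos_below J b d))"
proof -
  \<comment> \<open>If the two products agree, then \<open>c\<close> divides the first, so
    \<open>J c\<close> lies in \<open>J b\<close>; by symmetry the sets are equal, and injectivity
    gives \<open>b = c\<close>.\<close>
  have disj: "(\<lambda>m. m + Poly_Mapping.single b 1) ` chain_monos_below J b d \<inter>
      (\<lambda>m. m + Poly_Mapping.single c 1) ` chain_monos_below J c d = {}" if "b \<noteq> c" for b c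
  proof -
    have "J c \<subseteq> J b" if "m \<in> chain_monos_below J b d"
      "m + Poly_Mapping.single b 1 = n + Poly_Mapping.single c 1" for b c m n
    proof -
      have "c \<in> Poly_Mapping.keys (m + Poly_Mapping.single b 1)"
        using that(2) by (simp add: keys_add_nat)
      then show ?thesis using that(1) by (auto simp: keys_add_nat chain_monos_below_def split: if_splits)
    qed
    note sub = this
    have False if "m \<in> chain_monos_below J b d" "n \<in> chain_monos_below J c d"
      "m + Poly_Mapping.single b 1 = n + Poly_Mapping.single c 1" for m n
      using sub[OF that(1,3)] sub[OF that(2) that(3)[symmetric]] \<open>b \<noteq> c\<close> assms by (auto dest: injD)
    then show ?thesis by blast
  qed
  show ?thesis
    unfolding chain_monos_below_Suc using disj
    by (subst card_UN_disjoint)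
      (simp_all add: finite_chain_monos_below card_image inj_on_def)
qed

lemma chain_monos_fps_rec:
  fixes J :: "'a::finite \<Rightarrow> 'b set"
  assumes "inj J"
  defines "L \<equiv> \<lambda>a. Abs_fps (\<lambda>d. of_nat (card (chain_monos_below J a d))) :: 'c::comm_ring_1 fps"
  shows "L a = 1 + fps_X * (\<Sum>b | J b \<subseteq> J a. L b)"
proof (rule fps_ext)
  fix d
  show "fps_nth (L a) d = fps_nth (1 + fps_X * (\<Sum>b | J b \<subseteq> J a. L b)) d"
    by (cases d) (simp_all add: L_def chain_monos_below_0 card_chain_monos_below_Suc[OF assms(1)] fps_sum_nth)
qed

section \<open>Linear algebra: vanishing orders and complements\<close>

text \<open>Among the terms with nonzero coefficient, the one of least vanishing order cannot be
  cancelled by the others, which all vanish to strictly higher order.\<close>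

lemma distinct_order_independent:
  fixes f :: "'i \<Rightarrow> 'k::idom poly"
  assumes "finite S" "\<And>m. m \<in> S \<Longrightarrow> f m \<noteq> 0" "inj_on (\<lambda>m. order a (f m)) S"
    and sum: "(\<Sum>m\<in>S. smult (c m) (f m)) = 0" and "m \<in> S"
  shows "c m = 0"
proof (rule ccontr)
  assume "c m \<noteq> 0"
  define T where "T = {m\<in>S. c m \<noteq> 0}"
  have "finite T" "T \<noteq> {}" using assms \<open>c m \<noteq> 0\<close> by (auto simp: T_def)
  then obtain n where n: "n \<in> T" "\<And>k. k \<in> T \<Longrightarrow> order a (f n) \<le> order a (f k)"
    using arg_min_if_finite[of T "\<lambda>m. order a (f m)"]  by (metis linorder_not_less)
  have "(\<Sum>m\<in>T. smult (c m) (f m)) = 0"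
    using sum assms(1) unfolding T_def by (subst (asm) sum.mono_neutral_right[where S="{m\<in>S. c m \<noteq> 0}"]) auto
  then have "smult (c n) (f n) = - (\<Sum>m\<in>T - {n}. smult (c m) (f m))"
    using \<open>finite T\<close> n(1) by (simp add: sum.remove eq_neg_iff_add_eq_0)
  moreover have "[:- a, 1:] ^ Suc (order a (f n)) dvd (\<Sum>m\<in>T - {n}. smult (c m) (f m))"
  proof (rule dvd_sum)
    fix k assume k: "k \<in> T - {n}"
    then have "order a (f n) \<noteq> order a (f k)"
      using assms(3) n(1) by (auto simp: T_def dest: inj_onD)
    then have "Suc (order a (f n)) \<le> order a (f k)" using n(2)[of k] k by simp
    then have "[:- a, 1:] ^ Suc (order a (f n)) dvd f k"
      by (simp add: order_divides del: power_Suc)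
    then show "[:- a, 1:] ^ Suc (order a (f n)) dvd smult (c k) (f k)"
      by (rule dvd_smult)
  qed
  ultimately have "[:- a, 1:] ^ Suc (order a (f n)) dvd smult (c n) (f n)"
    by (simp only: dvd_minus_iff)
  then have "[:- a, 1:] ^ Suc (order a (f n)) dvd f n"
    using n(1) unfolding T_def order_divides by (auto simp: order_smult)
  then show False using n(1) assms(2)[of n] order_2[of "f n" a] by (auto simp: T_def)
qed

context vector_space
begin

text \<open>Adding a basis of \<open>K\<close> to \<open>S\<close> gives a basis of
  \<open>H\<close>. The finite set \<open>F\<close> bounds the size of independent sets in
  \<open>H\<close>, which makes the basis of \<open>K\<close> finite.\<close>

lemma dim_complement:
  assumes "finite F" "H \<subseteq> span F" "K \<subseteq> H" "S \<subseteq> H" "finite S" "independent S"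
    and "subspace K" "span S \<inter> K \<subseteq> {0}" "H \<subseteq> span (S \<union> K)"
  shows "dim H = card S + dim K"
proof -
  obtain B where B: "B \<subseteq> K" "independent B" "K \<subseteq> span B" "card B = dim K"
    using basis_exists[of K] by blast
  have finB: "finite B"
    using independent_span_bound[OF assms(1) B(2)] B(1) assms(2,3) by blast
  have KB: "span B = K"
    using B assms(7) by (simp add: span_minimal subset_antisym)
  have disj: "S \<inter> B = {}"
    using B(1,2) assms(6,8) span_superset[of S] dependent_zero[of S] by blast
  have "independent (S \<union> B)"
  proof
    assume "dependent (S \<union> B)"
    then obtain u where u: "(\<Sum>v\<in>S \<union> B. scale (u v) v) = 0" "\<exists>v\<in>S \<union> B. u v \<noteq> 0"
      using dependent_finite[of "S \<union> B"] assms(5) finB by auto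
    have sum: "(\<Sum>v\<in>S. scale (u v) v) + (\<Sum>v\<in>B. scale (u v) v) = 0"
      using u(1) assms(5) finB disj by (simp add: sum.union_disjoint)
    have inS: "(\<Sum>v\<in>S. scale (u v) v) \<in> span S"
      by (intro span_sum span_scale span_base)
    have inB: "(\<Sum>v\<in>B. scale (u v) v) \<in> K"
      unfolding KB[symmetric] by (intro span_sum span_scale span_base)
    have "(\<Sum>v\<in>S. scale (u v) v) = - (\<Sum>v\<in>B. scale (u v) v)"
      using sum by (simp add: eq_neg_iff_add_eq_0)
    then have "(\<Sum>v\<in>S. scale (u v) v) \<in> K"
      using subspace_neg[OF assms(7) inB] by simp
    then have "(\<Sum>v\<in>S. scale (u v) v) = 0" using inS assms(8) by blast
    moreover from this have "(\<Sum>v\<in>B. scale (u v) v) = 0" using sum by simp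
    ultimately have "\<forall>v\<in>S. u v = 0" "\<forall>v\<in>B. u v = 0"
      using independentD[OF assms(6,5) subset_refl] independentD[OF B(2) finB subset_refl] by blast+
    then show False using u(2) by blast
  qed
  moreover have "H \<subseteq> span (S \<union> B)"
  proof -
    have "S \<union> K \<subseteq> span (S \<union> B)"
      using span_superset[of "S \<union> B"] span_mono[of B "S \<union> B"] KB by auto
    then show ?thesis using assms(9) span_minimal[of "S \<union> K" "span (S \<union> B)"] subspace_span by blast
  qed
  ultimately have "dim H = card (S \<union> B)"
    using assms(3,4) B(1) by (intro dim_unique[of "S \<union> B"]) auto
  then show ?thesis using disj finB assms(5) B(4) by (simp add: card_Un_disjoint)
qed

end

section \<open>The lattice of matrix entries\<close>

text \<open>The entry at \<open>(i, j)\<close> corresponds to the strict partition \<open>row_shape i @ col_shape j\<close> with parts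
  at most 4, i.e. to a weight of the half-spin representation of dimension 16. \<open>boxes\<close> is the set of boxes
  of its shifted Young diagram, where the boxes of the largest diagram are numbered row by row
  (so that its rows start at 0, 4, 7 and 9).\<close>

definition row_shape :: "4 \<Rightarrow> nat list" where
  "row_shape i = (if i = 1 then [] else if i = 2 then [4, 3] else if i = 3 then [3] else [4])"

definition col_shape :: "4 \<Rightarrow> nat list" where
  "col_shape j = (if j = 1 then [] else if j = 2 then [2, 1] else if j = 3 then [1] else [2])"

definition boxes :: "4 \<times> 4 \<Rightarrow> nat set" where
  "boxes v = (\<Union>(s, l) \<in> set (zip [0, 4, 7, 9] (row_shape (fst v) @ col_shape (snd v))). {s..<s + l})"

lemma boxes_simps:
  "boxes (1, 1) = {}"
  "boxes (1, 2) = {0, 1, 4}"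
  "boxes (1, 3) = {0}"
  "boxes (1, 4) = {0, 1}"
  "boxes (2, 1) = {0, 1, 2, 3, 4, 5, 6}"
  "boxes (2, 2) = {0, 1, 2, 3, 4, 5, 6, 7, 8, 9}"
  "boxes (2, 3) = {0, 1, 2, 3, 4, 5, 6, 7}"
  "boxes (2, 4) = {0, 1, 2, 3, 4, 5, 6, 7, 8}"
  "boxes (3, 1) = {0, 1, 2}"
  "boxes (3, 2) = {0, 1, 2, 4, 5, 7}"
  "boxes (3, 3) = {0, 1, 2, 4}"
  "boxes (3, 4) = {0, 1, 2, 4, 5}"
  "boxes (4, 1) = {0, 1, 2, 3}"
  "boxes (4, 2) = {0, 1, 2, 3, 4, 5, 7}"
  "boxes (4, 3) = {0, 1, 2, 3, 4}"
  "boxes (4, 4) = {0, 1, 2, 3, 4, 5}"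
  by (simp_all add: boxes_def row_shape_def col_shape_def, auto)

lemma exhaust_4_4:
  fixes v :: "4 \<times> 4"
  obtains "v = (1, 1)" | "v = (1, 2)" | "v = (1, 3)" | "v = (1, 4)"
  | "v = (2, 1)" | "v = (2, 2)" | "v = (2, 3)" | "v = (2, 4)"
  | "v = (3, 1)" | "v = (3, 2)" | "v = (3, 3)" | "v = (3, 4)"
  | "v = (4, 1)" | "v = (4, 2)" | "v = (4, 3)" | "v = (4, 4)"
  using exhaust_4[of "fst v"] exhaust_4[of "snd v"] by (cases v) auto

lemma all_4_4: "(\<forall>v::4 \<times> 4. P v) \<longleftrightarrow>
    P (1, 1) \<and> P (1, 2) \<and> P (1, 3) \<and> P (1, 4) \<and> P (2, 1) \<and> P (2, 2) \<and> P (2, 3) \<and> P (2, 4) \<and>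
    P (3, 1) \<and> P (3, 2) \<and> P (3, 3) \<and> P (3, 4) \<and> P (4, 1) \<and> P (4, 2) \<and> P (4, 3) \<and> P (4, 4)"
  by (metis exhaust_4_4)

lemma inj_boxes: "inj boxes"
proof -
  have "\<forall>v w. boxes v = boxes w \<longrightarrow> v = w"
    unfolding all_4_4 boxes_simps set_eq_subset by simp
  then show ?thesis by (simp add: inj_def)
qed

definition incomparable :: "4 \<times> 4 \<Rightarrow> 4 \<times> 4 \<Rightarrow> bool" where
  "incomparable v w \<longleftrightarrow> \<not> boxes v \<subseteq> boxes w \<and> \<not> boxes w \<subseteq> boxes v"

text \<open>Each of the ten quadrics below contains the product of exactly one of these
  pairs.\<close>

lemma incomparable_cases:
  "\<forall>v w. incomparable v w \<longrightarrow>
    (\<exists>(a, b) \<in> {((4, 1), (3, 3)), ((1, 2), (3, 1)), ((4, 1), (3, 4)), ((1, 2), (4, 1)),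
      ((3, 2), (4, 3)), ((2, 1), (3, 2)), ((3, 2), (4, 4)), ((2, 1), (4, 2)),
      ((4, 3), (3, 4)), ((4, 1), (3, 2))}. v = a \<and> w = b \<or> v = b \<and> w = a)"
  unfolding incomparable_def all_4_4 boxes_simps by simp

section \<open>The quadrics cutting out the cone\<close>

lemma symJ_squared: "symJ ** symJ = - mat 1"
  by (simp add: vec_eq_iff forall_4 matrix_matrix_mult_def sum_4 symJ_def mat_def)

text \<open>The defining equation makes \<open>- symJ ** transpose M ** symJ\<close> a left inverse
  of \<open>M\<close>. For square matrices it is also a right inverse, and multiplying by
  \<open>symJ\<close> on the right gives the claim.\<close>

lemma Sp4_transpose:
  assumes "M \<in> Sp4"
  shows "M ** symJ ** transpose M = symJ"
proof -
  have M: "transpose M ** symJ ** M = symJ" using assms by (simp add: Sp4_def)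
  have neg: "(- A) ** B = - (A ** B)" "A ** (- B) = - (A ** B)" for A B :: "complex^4^4"
    by (simp_all add: vec_eq_iff matrix_matrix_mult_def sum_negf)
  have "(- symJ ** transpose M ** symJ) ** M = - symJ ** (transpose M ** symJ ** M)"
    by (simp only: matrix_mul_assoc)
  also have "\<dots> = mat 1"
    unfolding M by (simp add: neg symJ_squared)
  finally have "M ** (- symJ ** transpose M ** symJ) = mat 1"
    by (simp only: matrix_left_right_inverse)
  then have "M ** (- symJ ** transpose M ** symJ) ** symJ = symJ" by simp
  moreover have "M ** (- symJ ** transpose M ** symJ) ** symJ = M ** (- symJ ** transpose M) ** (symJ ** symJ)"
    by (simp only: matrix_mul_assoc)
  ultimately show ?thesis
    unfolding symJ_squared by (simp add: neg matrix_mul_assoc)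
qed

text \<open>Indexing by pairs matches the variables of \<open>mpoly16\<close>; the entries may also
  be polynomials, as on the curve below.\<close>

definition entry :: "'a^4^4 \<Rightarrow> 4 \<times> 4 \<Rightarrow> 'a" where
  "entry M v = M $ fst v $ snd v"

text \<open>The first four quadrics are column relations and the next four row relations. The last two are half
  the sum and half the difference of the remaining column relation and the remaining row relation.\<close>

definition quadrics :: "(4 \<times> 4 \<Rightarrow> 'a::comm_ring_1) \<Rightarrow> bool" where
  "quadrics x \<longleftrightarrow>
    x (1,1) * x (2,3) - x (2,1) * x (1,3) + x (3,1) * x (4,3) - x (4,1) * x (3,3) = 0 \<and>
    x (1,1) * x (2,4) - x (2,1) * x (1,4) + x (3,1) * x (4,4) - x (4,1) * x (3,4) = 0 \<and>
    x (1,2) * x (2,3) - x (2,2) * x (1,3) + x (3,2) * x (4,3) - x (4,2) * x (3,3) = 0 \<and>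
    x (1,2) * x (2,4) - x (2,2) * x (1,4) + x (3,2) * x (4,4) - x (4,2) * x (3,4) = 0 \<and>
    x (1,1) * x (3,2) - x (1,2) * x (3,1) + x (1,3) * x (3,4) - x (1,4) * x (3,3) = 0 \<and>
    x (1,1) * x (4,2) - x (1,2) * x (4,1) + x (1,3) * x (4,4) - x (1,4) * x (4,3) = 0 \<and>
    x (2,1) * x (3,2) - x (2,2) * x (3,1) + x (2,3) * x (3,4) - x (2,4) * x (3,3) = 0 \<and>
    x (2,1) * x (4,2) - x (2,2) * x (4,1) + x (2,3) * x (4,4) - x (2,4) * x (4,3) = 0 \<and>
    x (1,1) * x (2,2) - x (1,2) * x (2,1) - x (3,3) * x (4,4) + x (4,3) * x (3,4) = 0 \<and>
    x (3,1) * x (4,2) - x (4,1) * x (3,2) - x (1,3) * x (2,4) + x (2,3) * x (1,4) = 0"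

lemma quadrics_scale:
  assumes "quadrics x"
  shows "quadrics (\<lambda>v. c * x v)"
proof -
  have "c * a * (c * b) = c * c * (a * b)" for a b by (simp add: algebra_simps)
  then show ?thesis using assms
    unfolding quadrics_def by (simp only: right_diff_distrib[symmetric] distrib_left[symmetric] mult_zero_right)
qed

lemma Sp4_quadrics:
  assumes "M \<in> Sp4"
  shows "quadrics (entry M)"
proof -
  have cols: "transpose M ** symJ ** M = symJ" using assms by (simp add: Sp4_def)
  have rows: "M ** symJ ** transpose M = symJ" using assms by (rule Sp4_transpose)
  note exp = vec_eq_iff forall_4 matrix_matrix_mult_def sum_4 symJ_def transpose_def
  note c = cols[unfolded exp, simplified]
  note r = rows[unfolded exp, simplified]
  show ?thesis
    unfolding quadrics_def entry_def fst_conv snd_conv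
    by (intro conjI; use c r in algebra)
qed

lemma cone_quadrics:
  assumes "M \<in> cone_set Sp4"
  shows "quadrics (entry M)"
proof -
  obtain c N where "M = (\<chi> i j. c * N $ i $ j)" "N \<in> Sp4"
    using assms by (auto simp: cone_set_def)
  moreover from this have "entry M = (\<lambda>v. c * entry N v)" by (simp add: entry_def fun_eq_iff)
  ultimately show ?thesis using quadrics_scale[OF Sp4_quadrics, of N c] by simp
qed

text \<open>A partial converse of \<open>cone_quadrics\<close>. The first four quadrics and the sum
  of the last two say that \<open>transpose M ** symJ ** M\<close> is \<open>s\<close> times
  \<open>symJ\<close>, so dividing \<open>M\<close> by a square root of \<open>s\<close> gives a
  symplectic matrix.\<close>

lemma quadrics_in_cone:
  fixes M :: "complex^4^4"
  assumes q: "quadrics (entry M)"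
    and s: "s = M$1$1 * M$2$2 - M$2$1 * M$1$2 + M$3$1 * M$4$2 - M$4$1 * M$3$2" "s \<noteq> 0"
  shows "M \<in> cone_set Sp4"
proof -
  define c where "c = csqrt s"
  have c: "c * c = s" "c \<noteq> 0" using s by (auto simp: c_def simp flip: power2_eq_square)
  define N :: "complex^4^4" where "N = (\<chi> i j. M $ i $ j / c)"
  have "(transpose N ** symJ ** N) $ i $ j =
      (M$1$i * M$2$j - M$2$i * M$1$j + M$3$i * M$4$j - M$4$i * M$3$j) / s" for i j
    by (simp add: matrix_matrix_mult_def sum_4 symJ_def transpose_def N_def c diff_divide_distrib add_divide_distrib)
  moreover have "M$1$i * M$2$j - M$2$i * M$1$j + M$3$i * M$4$j - M$4$i * M$3$j = s * symJ $ i $ j" for i j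
  proof -
    have "\<forall>i j. M$1$i * M$2$j - M$2$i * M$1$j + M$3$i * M$4$j - M$4$i * M$3$j = s * symJ $ i $ j"
      unfolding forall_4 s(1) using q[unfolded quadrics_def entry_def fst_conv snd_conv]
      by (intro conjI; simp add: symJ_def; algebra)
    then show ?thesis by blast
  qed
  ultimately have "N \<in> Sp4"
    using s(2) by (simp add: Sp4_def vec_eq_iff)
  moreover have "M = (\<chi> i j. c * N $ i $ j)" using c by (simp add: N_def vec_eq_iff)
  ultimately show ?thesis unfolding cone_set_def by blast
qed

section \<open>A curve in the cone that separates chain monomials\<close>

lemma vector_4 [simp]:
  "(vector [a, b, c, d] :: 'a::zero^4) $ 1 = a"
  "(vector [a, b, c, d] :: 'a::zero^4) $ 2 = b"
  "(vector [a, b, c, d] :: 'a::zero^4) $ 3 = c"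
  "(vector [a, b, c, d] :: 'a::zero^4) $ 4 = d"
  by (simp_all add: vector_def)

text \<open>Up to signs, these are the coordinates of the product of the exponentials \<open>exp (t k f\<^sub>k)\<close> applied to the
  extremal vector of the half-spin representation, where \<open>f\<^sub>k\<close> is the simple root vector labelling box \<open>k\<close>.
  Hence the entry at \<open>v\<close> is the product of the \<open>t k\<close> over \<open>boxes v\<close>, plus terms in which some of these
  boxes are replaced by later ones.\<close>

definition curve :: "(nat \<Rightarrow> 'a::comm_ring_1) \<Rightarrow> 'a^4^4" where
  "curve t = vector [
    vector [1,
      t 0 * t 1 * t 4 + t 0 * t 1 * t 9 + t 0 * t 5 * t 9 + t 0 * t 8 * t 9 + t 7 * t 8 * t 9,
      - (t 0 + t 7),
      - (t 0 * t 1 + t 0 * t 5 + t 0 * t 8 + t 7 * t 8)],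
    vector [
      - (t 0 * t 1 * t 2 * t 3 * t 4 * t 5 * t 6),
      - (t 0 * t 1 * t 2 * t 3 * t 4 * t 5 * t 6 * t 7 * t 8 * t 9),
      t 0 * t 1 * t 2 * t 3 * t 4 * t 5 * t 6 * t 7,
      t 0 * t 1 * t 2 * t 3 * t 4 * t 5 * t 6 * t 7 * t 8],
    vector [
      t 0 * t 1 * t 2 + t 0 * t 1 * t 6 + t 0 * t 5 * t 6,
      t 0 * t 1 * t 2 * t 4 * t 5 * t 7,
      t 0 * t 1 * t 2 * t 4 + t 0 * t 1 * t 4 * t 6 + t 0 * t 1 * t 2 * t 9 + t 0 * t 1 * t 6 * t 9
        + t 0 * t 5 * t 6 * t 9,
      t 0 * t 1 * t 2 * t 4 * t 5 + t 0 * t 1 * t 2 * t 4 * t 8 + t 0 * t 1 * t 4 * t 6 * t 8],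
    vector [
      t 0 * t 1 * t 2 * t 3,
      t 0 * t 1 * t 2 * t 3 * t 4 * t 5 * t 7,
      t 0 * t 1 * t 2 * t 3 * t 4 + t 0 * t 1 * t 2 * t 3 * t 9,
      t 0 * t 1 * t 2 * t 3 * t 4 * t 5 + t 0 * t 1 * t 2 * t 3 * t 4 * t 8]]"

lemma quadrics_curve: "quadrics (entry (curve t))"
  unfolding quadrics_def entry_def fst_conv snd_conv curve_def vector_4
  by (intro conjI; simp add: algebra_simps)

lemma entry_curve_hom:
  fixes t :: "nat \<Rightarrow> 'a::comm_ring_1 poly"
  shows "poly (entry (curve t) v) z = entry (curve (\<lambda>k. poly (t k) z)) v"
  by (cases v rule: exhaust_4_4) (simp_all add: entry_def curve_def)

lemma monom_1_dvd_monom: "n \<le> k \<Longrightarrow> monom 1 n dvd (monom c k :: 'a::comm_semiring_1 poly)"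
  by (rule dvdI[of _ _ "monom c (k - n)"]) (simp add: mult_monom)

lemma order_0_monom_add:
  fixes r :: "'a::idom poly"
  assumes a: "a \<noteq> 0" and r: "monom 1 (Suc n) dvd r"
  shows "monom a n + r \<noteq> 0" "order 0 (monom a n + r) = n"
proof -
  have nd: "\<not> monom 1 (Suc n) dvd monom a n"
    using a by (simp add: monom_1_dvd_iff order_0_monom)
  then have nd': "\<not> monom 1 (Suc n) dvd monom a n + r"
    using r by (simp add: dvd_add_left_iff)
  then show nz: "monom a n + r \<noteq> 0" by auto
  have "monom 1 n dvd r" using r monom_1_dvd_monom[of n "Suc n" 1] by (meson dvd_trans le_SucI order_refl)
  then have "monom 1 n dvd monom a n + r" by (intro dvd_add monom_1_dvd_monom) auto
  then show "order 0 (monom a n + r) = n"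
    using nz nd' by (simp add: monom_1_dvd_iff)
qed

lemma order_prod_power:
  fixes f :: "'i \<Rightarrow> 'a::idom poly"
  assumes "\<And>i. i \<in> A \<Longrightarrow> f i \<noteq> 0"
  shows "order a (\<Prod>i\<in>A. f i ^ m i) = (\<Sum>i\<in>A. m i * order a (f i))"
proof -
  have pow: "order a (p ^ k) = k * order a p" if "p \<noteq> 0" for p :: "'a poly" and k
    by (induction k) (use that in \<open>simp_all add: order_mult\<close>)
  show ?thesis using assms
  proof (induction A rule: infinite_finite_induct)
    case (insert i A)
    then have "f i ^ m i * (\<Prod>i\<in>A. f i ^ m i) \<noteq> 0" by auto
    then show ?case using insert by (simp add: order_mult pow)
  qed auto
qed

abbreviation curve_at :: "(nat \<Rightarrow> nat) \<Rightarrow> complex poly^4^4" where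
  "curve_at e \<equiv> curve (\<lambda>k. monom 1 (e k))"

text \<open>As \<open>e\<close> increases, moving a box to a later one raises the exponent. The
  product over \<open>boxes v\<close> is therefore the unique term of lowest order, and its
  coefficient is 1 or -1.\<close>

lemma order_curve:
  assumes "strict_mono e"
  shows "entry (curve_at e) v \<noteq> 0 \<and> order 0 (entry (curve_at e) v) = (\<Sum>k\<in>boxes v. e k)"
proof -
  have lt: "e 0 < e 1" "e 1 < e 2" "e 2 < e 3" "e 3 < e 4" "e 4 < e 5"
    "e 5 < e 6" "e 6 < e 7" "e 7 < e 8" "e 8 < e 9"
    using assms by (simp_all add: strict_mono_less)
  have mono: "monom a n \<noteq> 0 \<and> order 0 (monom a n) = n'" if "a \<noteq> 0" "n = n'" for a :: complex and n n'
    using that by (simp add: order_0_monom)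
  have add: "monom a n + r \<noteq> 0 \<and> order 0 (monom a n + r) = n'"
    if "a \<noteq> 0" "n = n'" "monom 1 (Suc n) dvd r" for a :: complex and n n' r
    using that order_0_monom_add[of a n r] by blast
  \<comment> \<open>These rules write each entry as a single monomial or as its
    \<open>boxes v\<close> monomial plus a remainder, the forms that \<open>mono\<close> and
    \<open>add\<close> expect.\<close>
  note lin = add.assoc minus_add_distrib minus_monom mult_monom mult_1_left mult_1_right add_uminus_conv_diff[symmetric]
  show ?thesis
    apply (cases v rule: exhaust_4_4; hypsubst)
    unfolding boxes_simps entry_def fst_conv snd_conv curve_def vector_4 lin
    subgoal by simp
    by (rule mono add; (intro dvd_add monom_1_dvd_monom)?; use lt in simp)+
qed

text \<open>Here \<open>s\<close> is the factor of \<open>quadrics_in_cone\<close> along the curve.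
  Being a nonzero polynomial in \<open>z\<close>, it vanishes at finitely many points only.\<close>

lemma curve_in_cone:
  fixes e :: "nat \<Rightarrow> nat"
  defines "s \<equiv> entry (curve_at e) (1,1) * entry (curve_at e) (2,2) - entry (curve_at e) (2,1) * entry (curve_at e) (1,2)
      + entry (curve_at e) (3,1) * entry (curve_at e) (4,2) - entry (curve_at e) (4,1) * entry (curve_at e) (3,2)"
  shows "s \<noteq> 0"
    and "poly s z \<noteq> 0 \<Longrightarrow> curve (\<lambda>k. poly (monom 1 (e k)) z) \<in> cone_set Sp4"
proof -
  \<comment> \<open>At \<open>z = 1\<close> all parameters \<open>t k\<close> equal 1, so each entry
    is, up to sign, its number of terms.\<close>
  have "poly s 1 = 6"
    unfolding s_def by (simp add: entry_def curve_def poly_monom)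
  then show "s \<noteq> 0" by auto
  assume "poly s z \<noteq> 0"
  then show "curve (\<lambda>k. poly (monom 1 (e k)) z) \<in> cone_set Sp4"
    by (intro quadrics_in_cone[OF quadrics_curve refl])
      (simp add: s_def entry_curve_hom, simp add: entry_def)
qed

definition mono_curve :: "(nat \<Rightarrow> nat) \<Rightarrow> (4 \<times> 4 \<Rightarrow>\<^sub>0 nat) \<Rightarrow> complex poly" where
  "mono_curve e m = (\<Prod>v\<in>UNIV. entry (curve_at e) v ^ Poly_Mapping.lookup m v)"

lemma mono_curve_nonzero: "strict_mono e \<Longrightarrow> mono_curve e m \<noteq> 0"
  using order_curve by (simp add: mono_curve_def)

lemma poly_mono_curve: "poly (mono_curve e m) z = mon_eval m (curve (\<lambda>k. poly (monom 1 (e k)) z))"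
  by (simp add: mono_curve_def mon_eval_def poly_prod poly_power entry_curve_hom) (simp add: entry_def)

lemma boxes_subset: "boxes v \<subseteq> {..<10}"
  by (cases v rule: exhaust_4_4) (simp_all add: boxes_simps)

text \<open>Exchanging the order of summation collects the contribution of each box
  \<open>k\<close>: the number of factors, with multiplicity, whose diagram contains it.\<close>

lemma order_mono_curve:
  assumes "strict_mono e"
  shows "order 0 (mono_curve e m) = (\<Sum>k<10. (\<Sum>v | k \<in> boxes v. Poly_Mapping.lookup m v) * e k)"
proof -
  have "order 0 (mono_curve e m) = (\<Sum>v\<in>UNIV. Poly_Mapping.lookup m v * (\<Sum>k\<in>boxes v. e k))"
    unfolding mono_curve_def using order_curve[OF assms] by (simp add: order_prod_power)
  also have "\<dots> = (\<Sum>v\<in>UNIV. \<Sum>k<10. if k \<in> boxes v then Poly_Mapping.lookup m v * e k else 0)"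
  proof (rule sum.cong)
    fix v
    show "Poly_Mapping.lookup m v * (\<Sum>k\<in>boxes v. e k) =
        (\<Sum>k<10. if k \<in> boxes v then Poly_Mapping.lookup m v * e k else 0)"
      using boxes_subset[of v] 
      by (simp add: sum.If_cases sum_distrib_left Int_absorb1 flip: sum.inter_restrict)
  qed simp
  also have "\<dots> = (\<Sum>k<10. \<Sum>v\<in>UNIV. if k \<in> boxes v then Poly_Mapping.lookup m v * e k else 0)"
    by (rule sum.swap)
  also have "\<dots> = (\<Sum>k<10. (\<Sum>v | k \<in> boxes v. Poly_Mapping.lookup m v) * e k)"
    by (simp add: sum.If_cases sum_distrib_right)
  finally show ?thesis .
qed

text \<open>In base \<open>d + 2\<close> the digits of the vanishing order are the box counts, each
  at most \<open>d\<close>. The order thus determines the box counts, and these determine the chain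
  monomial by \<open>chain_eqI\<close>.\<close>

lemma inj_order_mono_curve:
  "inj_on (\<lambda>m. order 0 (mono_curve (\<lambda>k. (d + 2) ^ k) m)) (chain_monos boxes d)"
proof (rule inj_onI)
  fix m n
  assume m: "m \<in> chain_monos boxes d" and n: "n \<in> chain_monos boxes d"
    and eq: "order 0 (mono_curve (\<lambda>k. (d + 2) ^ k) m) = order 0 (mono_curve (\<lambda>k. (d + 2) ^ k) n)"
  \<comment> \<open>Base \<open>d + 1\<close> would bound the digits too, but for
    \<open>d = 0\<close> its powers are constant and not increasing.\<close>
  have sm: "strict_mono (\<lambda>k. (d + 2) ^ k)" by (simp add: strict_mono_def)
  have bound: "(\<Sum>v | k \<in> boxes v. Poly_Mapping.lookup u v) < d + 2" if "u \<in> chain_monos boxes d" for u k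
  proof -
    have "(\<Sum>v | k \<in> boxes v. Poly_Mapping.lookup u v) \<le> mdeg u"
      unfolding mdeg_def by (rule sum_mono2) auto
    then show ?thesis using that by (simp add: chain_monos_def)
  qed
  have eqs: "(\<Sum>v | k \<in> boxes v. Poly_Mapping.lookup m v) = (\<Sum>v | k \<in> boxes v. Poly_Mapping.lookup n v)" for k
  proof (cases "k < 10")
    case True
    show ?thesis
      by (rule digits_unique[where n = 10 and B = "d + 2"])
        (use bound m n eq True sm in \<open>simp_all add: order_mono_curve\<close>)
  next
    case False
    then have "{v. k \<in> boxes v} = {}" using boxes_subset by fastforce
    then show ?thesis by (simp only: sum.empty)
  qed
  have deg: "sum (Poly_Mapping.lookup m) UNIV = sum (Poly_Mapping.lookup n) UNIV"
    using m n by (simp add: chain_monos_def mdeg_def)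
  have "Poly_Mapping.lookup m = Poly_Mapping.lookup n"
  proof (rule chain_eqI[of boxes, OF inj_boxes])
    show "boxes v \<subseteq> boxes w \<or> boxes w \<subseteq> boxes v"
      if "Poly_Mapping.lookup m v \<noteq> 0" "Poly_Mapping.lookup m w \<noteq> 0" for v w
      by (rule chain_monosD[OF m that])
    show "boxes v \<subseteq> boxes w \<or> boxes w \<subseteq> boxes v"
      if "Poly_Mapping.lookup n v \<noteq> 0" "Poly_Mapping.lookup n w \<noteq> 0" for v w
      by (rule chain_monosD[OF n that])
  qed (rule deg eqs)+
  then show "m = n" by (simp only: poly_mapping_eq_iff)
qed

section \<open>Polynomial functions on the cone\<close>

lemma mon_deg_eq_mdeg: "mon_deg m = mdeg m"
  by (simp add: mon_deg_def mdeg_def)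

lemma lookup_pscale: "Poly_Mapping.lookup (pscale c p) m = c * Poly_Mapping.lookup p m"
  by (simp add: pscale_def Poly_Mapping.map.rep_eq when_def)

lemma pscale_single: "pscale c (Poly_Mapping.single m a) = Poly_Mapping.single m (c * a)"
  by (rule poly_mapping_eqI) (simp add: lookup_pscale lookup_single when_def)

interpretation pscale: vector_space pscale
  by unfold_locales (rule poly_mapping_eqI; simp add: lookup_pscale lookup_add algebra_simps)+

lemma peval_superset:
  assumes "finite A" "Poly_Mapping.keys p \<subseteq> A"
  shows "peval p M = (\<Sum>m\<in>A. Poly_Mapping.lookup p m * mon_eval m M)"
  unfolding peval_def using assms by (intro sum.mono_neutral_left) (auto simp: in_keys_iff)

lemma peval_add: "peval (p + q) M = peval p M + peval q M"
proof -
  have fin: "finite (Poly_Mapping.keys p \<union> Poly_Mapping.keys q)" by simp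
  show ?thesis
    by (subst (1 2 3) peval_superset[OF fin])
      (use keys_add[of p q] in \<open>auto simp: lookup_add sum.distrib algebra_simps\<close>)
qed

lemma peval_pscale: "peval (pscale c p) M = c * peval p M"
proof -
  have "peval (pscale c p) M = (\<Sum>m\<in>Poly_Mapping.keys p. Poly_Mapping.lookup (pscale c p) m * mon_eval m M)"
    by (rule peval_superset) (auto simp: in_keys_iff lookup_pscale)
  then show ?thesis by (simp add: peval_def lookup_pscale sum_distrib_left mult.assoc)
qed

lemma peval_diff: "peval (p - q) M = peval p M - peval q M"
  using peval_add[of "p - q" q M] by simp

lemma peval_0: "peval 0 M = 0"
  by (simp add: peval_def)

lemma peval_single: "peval (Poly_Mapping.single m c) M = c * mon_eval m M"
  by (simp add: peval_def)

lemma mon_eval_add: "mon_eval (m + n) M = mon_eval m M * mon_eval n M"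
  by (simp add: mon_eval_def lookup_add power_add prod.distrib)

lemma mon_eval_single: "mon_eval (Poly_Mapping.single v 1) M = entry M v"
proof -
  have "mon_eval (Poly_Mapping.single v 1) M = (\<Prod>w\<in>UNIV. if w = v then entry M v else 1)"
    unfolding mon_eval_def by (intro prod.cong) (auto simp: lookup_single entry_def)
  then show ?thesis by simp
qed

abbreviation cone_ideal :: "mpoly16 set" where
  "cone_ideal \<equiv> vanishing_ideal (zariski_closure (cone_set Sp4))"

text \<open>A polynomial vanishing on a set vanishes on its Zariski closure by definition, so only
  points of the cone need testing.\<close>

lemma cone_ideal_iff: "p \<in> cone_ideal \<longleftrightarrow> (\<forall>M\<in>cone_set Sp4. peval p M = 0)"
  by (auto simp: vanishing_ideal_def zariski_closure_def)

lemma subspace_hom_polys: "pscale.subspace (hom_polys d)"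
  unfolding pscale.subspace_def hom_polys_def
  using keys_add by (auto simp: in_keys_iff lookup_pscale lookup_add) 

lemma subspace_cone_ideal: "pscale.subspace cone_ideal"
  by (simp add: pscale.subspace_def cone_ideal_iff peval_0 peval_add peval_pscale)

lemma single_in_hom_polys: "mon_deg m = d \<Longrightarrow> Poly_Mapping.single m c \<in> hom_polys d"
  by (auto simp: hom_polys_def split: if_splits)

lemma finite_mon_deg: "finite {m. mon_deg m = d}"
proof -
  \<comment> \<open>For a constant \<open>J\<close> every monomial is a chain monomial and lies
    below every element.\<close>
  have "{m. mon_deg m = d} = chain_monos_below (\<lambda>_. {} :: nat set) undefined d"
    by (simp add: chain_monos_below_def chain_monos_def mon_deg_eq_mdeg)
  then show ?thesis by (simp add: finite_chain_monos_below)
qed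

lemma mpoly_eq_sum: "p = (\<Sum>m\<in>Poly_Mapping.keys p. pscale (Poly_Mapping.lookup p m) (Poly_Mapping.single m 1))"
proof (rule poly_mapping_eqI)
  fix k
  show "Poly_Mapping.lookup p k =
    Poly_Mapping.lookup (\<Sum>m\<in>Poly_Mapping.keys p. pscale (Poly_Mapping.lookup p m) (Poly_Mapping.single m 1)) k"
    by (simp add: lookup_sum pscale_single lookup_single when_def in_keys_iff)
qed

lemma hom_polys_subset_span:
  "hom_polys d \<subseteq> pscale.span ((\<lambda>m. Poly_Mapping.single m 1) ` {m. mon_deg m = d})"
proof
  fix p assume "p \<in> hom_polys d"
  then show "p \<in> pscale.span ((\<lambda>m. Poly_Mapping.single m 1) ` {m. mon_deg m = d})"
    by (subst mpoly_eq_sum) (intro pscale.span_sum pscale.span_scale pscale.span_base, auto simp: hom_polys_def)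
qed

section \<open>Straightening\<close>

text \<open>The quadrics preserve the total number of boxes, and straightening makes the two diagrams of a product
  more unequal, so the sum of the squared sizes increases.\<close>

definition height :: "4 \<times> 4 \<Rightarrow> nat" where
  "height v = card (boxes v) ^ 2"

lemma height_simps:
  "height (1, 1) = 0" "height (1, 2) = 9" "height (1, 3) = 1" "height (1, 4) = 4"
  "height (2, 1) = 49" "height (2, 2) = 100" "height (2, 3) = 64" "height (2, 4) = 81"
  "height (3, 1) = 9" "height (3, 2) = 36" "height (3, 3) = 16" "height (3, 4) = 25"
  "height (4, 1) = 16" "height (4, 2) = 49" "height (4, 3) = 25" "height (4, 4) = 36"
  unfolding height_def boxes_simps by (simp_all add: power2_eq_square)

definition straightens :: "4 \<times> 4 \<Rightarrow> 4 \<times> 4 \<Rightarrow> (complex \<times> (4 \<times> 4) \<times> (4 \<times> 4)) list \<Rightarrow> bool" where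
  "straightens v w T \<longleftrightarrow>
    (\<forall>x. quadrics x \<longrightarrow> x v * x w = (\<Sum>(c, a, b)\<leftarrow>T. c * x a * x b)) \<and>
    (\<forall>(c, a, b)\<in>set T. height v + height w < height a + height b)"

lemma straightens_commute: "straightens v w T \<Longrightarrow> straightens w v T"
  by (simp add: straightens_def mult.commute add.commute)

text \<open>Each quadric, in the order of \<open>quadrics\<close>, solved for the product of its
  incomparable pair.\<close>

lemma straightening_relations:
  "straightens (4,1) (3,3) [(1, (1,1), (2,3)), (-1, (2,1), (1,3)), (1, (3,1), (4,3))]"
  "straightens (4,1) (3,4) [(1, (1,1), (2,4)), (-1, (2,1), (1,4)), (1, (3,1), (4,4))]"
  "straightens (3,2) (4,3) [(-1, (1,2), (2,3)), (1, (2,2), (1,3)), (1, (4,2), (3,3))]"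
  "straightens (3,2) (4,4) [(-1, (1,2), (2,4)), (1, (2,2), (1,4)), (1, (4,2), (3,4))]"
  "straightens (1,2) (3,1) [(1, (1,1), (3,2)), (1, (1,3), (3,4)), (-1, (1,4), (3,3))]"
  "straightens (1,2) (4,1) [(1, (1,1), (4,2)), (1, (1,3), (4,4)), (-1, (1,4), (4,3))]"
  "straightens (2,1) (3,2) [(1, (2,2), (3,1)), (-1, (2,3), (3,4)), (1, (2,4), (3,3))]"
  "straightens (2,1) (4,2) [(1, (2,2), (4,1)), (-1, (2,3), (4,4)), (1, (2,4), (4,3))]"
  "straightens (4,3) (3,4) [(-1, (1,1), (2,2)), (1, (1,2), (2,1)), (1, (3,3), (4,4))]"
  "straightens (4,1) (3,2) [(1, (3,1), (4,2)), (-1, (1,3), (2,4)), (1, (2,3), (1,4))]"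
  unfolding straightens_def quadrics_def by (simp_all add: height_simps; algebra)+

lemma incomparable_straightens:
  assumes "incomparable v w"
  shows "\<exists>T. straightens v w T"
proof -
  have *: "\<exists>T. straightens v w T" if "v = a \<and> w = b \<or> v = b \<and> w = a" "straightens a b T" for a b T
    using that straightens_commute by blast
  show ?thesis
    using incomparable_cases[rule_format, OF assms] by (auto intro: * straightening_relations straightens_commute)
qed


text \<open>The largest diagram has ten boxes, hence height 100. The bound makes straightening
  terminate.\<close>

lemma mon_height_le: "(\<Sum>v\<in>UNIV. Poly_Mapping.lookup m v * height v) \<le> 100 * mdeg m"
proof -
  have "height v \<le> 100" for v
    by (cases v rule: exhaust_4_4) (simp_all add: height_simps)
  then show ?thesis
    unfolding mdeg_def sum_distrib_left by (intro sum_mono) (simp add: mult.commute)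
qed

text \<open>Induction on the gap between the total height and its bound \<open>100 * d\<close>. In a
  monomial that is not a chain, an incomparable pair is rewritten modulo the ideal, which yields
  monomials of the same degree and greater height.\<close>

lemma single_in_span_chain_monos:
  assumes "mdeg m = d"
  shows "Poly_Mapping.single m 1 \<in>
    pscale.span ((\<lambda>m. Poly_Mapping.single m 1) ` chain_monos boxes d \<union> (hom_polys d \<inter> cone_ideal))"
    (is "_ \<in> pscale.span ?G")
  using assms
proof (induction "100 * d - (\<Sum>v\<in>UNIV. Poly_Mapping.lookup m v * height v)" arbitrary: m rule: less_induct)
  case less
  show ?case
  proof (cases "m \<in> chain_monos boxes d")
    case True
    then show ?thesis by (intro pscale.span_base) blast
  next
    case False
    then obtain v w where vw: "v \<in> Poly_Mapping.keys m" "w \<in> Poly_Mapping.keys m" "incomparable v w"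
      using less.prems unfolding chain_monos_def incomparable_def by blast
    obtain T where T: "straightens v w T" using incomparable_straightens[OF vw(3)] by blast
    have "v \<noteq> w" using vw(3) by (auto simp: incomparable_def)
    define n where "n = m - Poly_Mapping.single v 1 - Poly_Mapping.single w 1"
    have m: "m = n + Poly_Mapping.single w 1 + Poly_Mapping.single v 1"
    proof -
      have "w \<in> Poly_Mapping.keys (m - Poly_Mapping.single v 1)"
        using vw(2) \<open>v \<noteq> w\<close> by (simp add: in_keys_iff lookup_minus lookup_single)
      then show ?thesis
        unfolding n_def using diff_single_add[OF vw(1)] diff_single_add by metis
    qed
    define mm where "mm a b = n + Poly_Mapping.single a 1 + Poly_Mapping.single b 1" for a b
    have deg: "mdeg (mm a b) = d" for a b
      using less.prems unfolding m mm_def by (simp add: mdeg_add)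
    have ht: "(\<Sum>u\<in>UNIV. Poly_Mapping.lookup (mm a b) u * height u) =
        (\<Sum>u\<in>UNIV. Poly_Mapping.lookup n u * height u) + (height a + height b)" for a b
    proof -
      have "(\<Sum>u\<in>UNIV. Poly_Mapping.lookup (Poly_Mapping.single a (1::nat)) u * height u) = height a" for a
        by (simp add: lookup_single when_def if_distrib[of "\<lambda>x. x * _"] cong: if_cong)
      then show ?thesis
        by (simp add: mm_def lookup_add algebra_simps sum.distrib)
    qed
    have mwv: "m = mm w v" by (simp add: m mm_def)
    have IH: "Poly_Mapping.single (mm a b) 1 \<in> pscale.span ?G" if "(c, a, b) \<in> set T" for c a b
    proof (rule less.hyps[OF _ deg])
      have "height v + height w < height a + height b"
        using T that by (auto simp: straightens_def)
      then show "100 * d - (\<Sum>u\<in>UNIV. Poly_Mapping.lookup (mm a b) u * height u)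
          < 100 * d - (\<Sum>u\<in>UNIV. Poly_Mapping.lookup m u * height u)"
        using mon_height_le[of "mm a b"] unfolding deg ht mwv by linarith
    qed
    \<comment> \<open>The result of replacing the product of \<open>v\<close> and \<open>w\<close>
      in \<open>m\<close> by its straightened form; it agrees with \<open>m\<close> on the
      cone.\<close>
    define r where "r = (\<Sum>(c, a, b)\<leftarrow>T. pscale c (Poly_Mapping.single (mm a b) 1))"
    have r_span: "r \<in> pscale.span ?G"
    proof -
      have "(\<Sum>(c, a, b)\<leftarrow>T'. pscale c (Poly_Mapping.single (mm a b) 1)) \<in> pscale.span ?G"
        if "set T' \<subseteq> set T" for T'
        using that by (induction T') (auto intro: pscale.span_zero pscale.span_add pscale.span_scale IH)
      then show ?thesis unfolding r_def by blast
    qed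
    have r_hom: "r \<in> hom_polys d"
      unfolding r_def
      by (induction T) (auto intro!: pscale.subspace_add[OF subspace_hom_polys]
          pscale.subspace_scale[OF subspace_hom_polys] pscale.subspace_0[OF subspace_hom_polys]
          single_in_hom_polys simp: mon_deg_eq_mdeg deg)
    have r_eval: "peval r M = mon_eval n M * (\<Sum>(c, a, b)\<leftarrow>T. c * entry M a * entry M b)" for M
      unfolding r_def
      by (induction T)
        (auto simp: peval_0 peval_add peval_pscale peval_single mm_def mon_eval_add
          mon_eval_single[unfolded One_nat_def] algebra_simps)
    have "Poly_Mapping.single m 1 - r \<in> hom_polys d"
      by (intro pscale.subspace_diff[OF subspace_hom_polys] r_hom single_in_hom_polys)
        (simp add: mon_deg_eq_mdeg less.prems)
    moreover have "Poly_Mapping.single m 1 - r \<in> cone_ideal"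
      unfolding cone_ideal_iff
    proof
      fix M assume "M \<in> cone_set Sp4"
      then have "entry M v * entry M w = (\<Sum>(c, a, b)\<leftarrow>T. c * entry M a * entry M b)"
        using T cone_quadrics by (simp add: straightens_def)
      then show "peval (Poly_Mapping.single m 1 - r) M = 0"
        by (simp add: peval_diff peval_single r_eval m mon_eval_add mon_eval_single[unfolded One_nat_def] mult.assoc mult.commute)
    qed
    ultimately have "Poly_Mapping.single m 1 - r \<in> pscale.span ?G"
      by (intro pscale.span_base) blast
    then have "Poly_Mapping.single m 1 - r + r \<in> pscale.span ?G"
      using r_span by (rule pscale.span_add)
    then show ?thesis by simp
  qed
qed

section \<open>Chain monomials form a basis\<close>

lemma finite_chain_monos: "finite (chain_monos boxes d)"
  by (rule finite_subset[OF _ finite_mon_deg[of d]]) (auto simp: chain_monos_def mon_deg_eq_mdeg)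

text \<open>Restricted to the curve, \<open>p\<close> becomes a combination \<open>P\<close> of
  polynomials with distinct vanishing orders at 0. Since \<open>P\<close> is zero, all coefficients
  of \<open>p\<close> vanish.\<close>

lemma chain_monos_cone_ideal:
  assumes p: "p \<in> cone_ideal" and keys: "Poly_Mapping.keys p \<subseteq> chain_monos boxes d"
  shows "p = 0"
proof -
  define e where "e k = (d + 2) ^ k" for k :: nat
  have sm: "strict_mono e" by (simp add: strict_mono_def e_def)
  define P where "P = (\<Sum>m\<in>chain_monos boxes d. smult (Poly_Mapping.lookup p m) (mono_curve e m))"
  have P: "poly P z = peval p (curve (\<lambda>k. poly (monom 1 (e k)) z))" for z
    by (simp add: P_def poly_sum poly_mono_curve peval_superset[OF finite_chain_monos keys])
  obtain s where s: "s \<noteq> 0" "\<And>z. poly s z \<noteq> 0 \<Longrightarrow> curve (\<lambda>k. poly (monom 1 (e k)) z) \<in> cone_set Sp4"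
    using curve_in_cone[of e] by blast
  \<comment> \<open>The factor \<open>s\<close> takes care of the points \<open>z\<close> at which
    the curve is not known to lie in the cone.\<close>
  have "poly (P * s) z = 0" for z
    using s(2)[of z] p by (auto simp: P cone_ideal_iff)
  then have "P * s = 0" using poly_all_0_iff_0 by blast
  then have P0: "P = 0" using s(1) by simp
  have "Poly_Mapping.lookup p m = 0" if "m \<in> chain_monos boxes d" for m
    by (rule distinct_order_independent[where f = "mono_curve e" and a = 0, OF finite_chain_monos _ _ P0[unfolded P_def] that])
      (use mono_curve_nonzero[OF sm] inj_order_mono_curve[of d] in \<open>auto simp: e_def[abs_def]\<close>)
  then have "Poly_Mapping.keys p = {}" using keys unfolding in_keys_iff by (meson equals0I in_keys_iff subsetD)
  then show ?thesis by (simp only: keys_eq_empty)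
qed

text \<open>The chain monomials of degree \<open>d\<close> are a basis of a complement of the degree
  \<open>d\<close> part of the ideal: they span by straightening and meet the ideal trivially by the
  curve argument.\<close>

lemma coord_ring_dim_cone:
  "coord_ring_dim (zariski_closure (cone_set Sp4)) d = card (chain_monos boxes d)"
proof -
  let ?C = "chain_monos boxes d"
  let ?S = "(\<lambda>m. Poly_Mapping.single m (1::complex)) ` ?C"
  let ?K = "hom_polys d \<inter> cone_ideal"
  have inj: "inj_on (\<lambda>m. Poly_Mapping.single m (1::complex)) A" for A :: "(4 \<times> 4 \<Rightarrow>\<^sub>0 nat) set"
    by (rule inj_onI) (metis lookup_single_eq lookup_single_not_eq one_neq_zero)
  have keys: "Poly_Mapping.keys p \<subseteq> ?C" if "p \<in> pscale.span ?S" for p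
    using that
  proof (induction rule: pscale.span_induct_alt)
    case base
    then show ?case by simp
  next
    case (step c x y)
    then show ?case
      using keys_add[of "pscale c x" y] by (auto simp: pscale_single split: if_splits)
  qed
  have indep: "pscale.independent ?S"
  proof
    assume "pscale.dependent ?S"
    then obtain u where u: "(\<Sum>x\<in>?S. pscale (u x) x) = 0" "\<exists>x\<in>?S. u x \<noteq> 0"
      using pscale.dependent_finite[of ?S] finite_chain_monos by auto
    have "(\<Sum>m\<in>?C. Poly_Mapping.single m (u (Poly_Mapping.single m 1))) = 0"
      using u(1) by (simp add: sum.reindex[OF inj] pscale_single)
    then have eq0: "Poly_Mapping.lookup (\<Sum>m\<in>?C. Poly_Mapping.single m (u (Poly_Mapping.single m 1))) k = 0" for k
      by simp
    have "u (Poly_Mapping.single k 1) = 0" if "k \<in> ?C" for k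
      using that finite_chain_monos[of d] eq0[of k] by (simp add: lookup_sum lookup_single when_def)
    then show False using u(2) by blast
  qed
  have "pscale.dim (hom_polys d) = card ?S + pscale.dim ?K"
  proof (rule pscale.dim_complement)
    show "finite ((\<lambda>m. Poly_Mapping.single m (1::complex)) ` {m. mon_deg m = d})"
      using finite_mon_deg by simp
    show "hom_polys d \<subseteq> pscale.span ((\<lambda>m. Poly_Mapping.single m 1) ` {m. mon_deg m = d})"
      by (rule hom_polys_subset_span)
    show "?S \<subseteq> hom_polys d"
      by (auto intro!: single_in_hom_polys simp: chain_monos_def mon_deg_eq_mdeg)
    show "finite ?S" using finite_chain_monos by simp
    show "pscale.subspace ?K"
      by (intro pscale.subspace_inter subspace_hom_polys subspace_cone_ideal)
    show "pscale.span ?S \<inter> ?K \<subseteq> {0}"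
      using chain_monos_cone_ideal keys by blast
    have "(\<lambda>m. Poly_Mapping.single m 1) ` {m. mon_deg m = d} \<subseteq> pscale.span (?S \<union> ?K)"
      using single_in_span_chain_monos by (auto simp: mon_deg_eq_mdeg)
    then show "hom_polys d \<subseteq> pscale.span (?S \<union> ?K)"
      using hom_polys_subset_span[of d] pscale.span_minimal[OF _ pscale.subspace_span] by blast
  qed (use indep in auto)
  then show ?thesis
    by (simp add: coord_ring_dim_def card_image[OF inj])
qed

section \<open>The Hilbert series\<close>

lemma sum_4_4: "(\<Sum>v\<in>UNIV. f v) =
    f (1, 1) + f (1, 2) + f (1, 3) + f (1, 4) + f (2, 1) + f (2, 2) + f (2, 3) + f (2, 4) +
    f (3, 1) + f (3, 2) + f (3, 3) + f (3, 4) + f (4, 1) + f (4, 2) + f (4, 3) + f (4, 4)"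
  for f :: "4 \<times> 4 \<Rightarrow> 'a::comm_monoid_add"
proof -
  have "(\<Sum>v\<in>UNIV. f v) = (\<Sum>i\<in>UNIV. \<Sum>j\<in>UNIV. f (i, j))"
    by (simp add: sum.cartesian_product)
  then show ?thesis by (simp add: sum_4 add.assoc)
qed

lemma chain_series_top:
  defines "L \<equiv> \<lambda>a. Abs_fps (\<lambda>d. of_nat (card (chain_monos_below boxes a d))) :: rat fps"
  defines "u \<equiv> inverse (1 - fps_X) :: rat fps"
  shows "L (2, 2) = 12 * u ^ 11 - 18 * u ^ 10 + 8 * u ^ 9 - u ^ 8"
proof -
  have u1: "u * (1 - fps_X) = 1"
    unfolding u_def by (rule inverse_mult_eq_1) simp
  \<comment> \<open>The counting recursion has \<open>L a\<close> on both sides. Solving for it,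
    with \<open>fps_X * u = u - 1\<close>, leaves only strictly smaller diagrams on the
    right.\<close>
  have rec: "L a = u + (u - 1) * (\<Sum>b\<in>UNIV. if boxes b \<subset> boxes a then L b else 0)" for a
  proof -
    have S: "{b. boxes b \<subseteq> boxes a} = insert a {b. boxes b \<subset> boxes a}"
      using inj_boxes by (auto dest: injD)
    have "L a = 1 + fps_X * (L a + (\<Sum>b | boxes b \<subset> boxes a. L b))"
      unfolding L_def by (subst chain_monos_fps_rec[OF inj_boxes]) (simp add: S)
    then have "L a = u + (u - 1) * (\<Sum>b | boxes b \<subset> boxes a. L b)"
      using u1 by algebra
    then show ?thesis by (simp add: sum.If_cases)
  qed
  \<comment> \<open>The lattice elements are taken in an order extending inclusion, so all smaller
    series are already known as polynomials in \<open>u\<close>.\<close>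
  have L11: "L (1, 1) = u"
    by (subst rec) (simp add: sum_4_4 boxes_simps less_le_not_le)
  have L13: "L (1, 3) = u ^ 2"
    by (subst rec) (simp add: sum_4_4 boxes_simps less_le_not_le L11 algebra_simps power_numeral_reduce)
  have L14: "L (1, 4) = u ^ 3"
    by (subst rec) (simp add: sum_4_4 boxes_simps less_le_not_le L11 L13 algebra_simps power_numeral_reduce)
  have L12: "L (1, 2) = u ^ 4"
    by (subst rec) (simp add: sum_4_4 boxes_simps less_le_not_le L11 L13 L14 algebra_simps power_numeral_reduce)
  have L31: "L (3, 1) = u ^ 4"
    by (subst rec) (simp add: sum_4_4 boxes_simps less_le_not_le L11 L13 L14 algebra_simps power_numeral_reduce)
  have L33: "L (3, 3) = 2 * u ^ 5 - u ^ 4"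
    by (subst rec) (simp add: sum_4_4 boxes_simps less_le_not_le L11 L13 L14 L12 L31 algebra_simps power_numeral_reduce)
  have L41: "L (4, 1) = u ^ 5"
    by (subst rec) (simp add: sum_4_4 boxes_simps less_le_not_le L11 L13 L14 L31 algebra_simps power_numeral_reduce)
  have L34: "L (3, 4) = 2 * u ^ 6 - u ^ 5"
    by (subst rec) (simp add: sum_4_4 boxes_simps less_le_not_le L11 L13 L14 L12 L31 L33 algebra_simps power_numeral_reduce)
  have L43: "L (4, 3) = 3 * u ^ 6 - 2 * u ^ 5"
    by (subst rec) (simp add: sum_4_4 boxes_simps less_le_not_le L11 L13 L14 L12 L31 L33 L41 algebra_simps power_numeral_reduce)
  have L32: "L (3, 2) = 2 * u ^ 7 - u ^ 6"
    by (subst rec) (simp add: sum_4_4 boxes_simps less_le_not_le L11 L13 L14 L12 L31 L33 L34 algebra_simps power_numeral_reduce)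
  have L44: "L (4, 4) = 5 * u ^ 7 - 5 * u ^ 6 + u ^ 5"
    by (subst rec) (simp add: sum_4_4 boxes_simps less_le_not_le L11 L13 L14 L12 L31 L33 L41 L34 L43 algebra_simps power_numeral_reduce)
  have L21: "L (2, 1) = 5 * u ^ 8 - 5 * u ^ 7 + u ^ 6"
    by (subst rec) (simp add: sum_4_4 boxes_simps less_le_not_le L11 L13 L14 L12 L31 L33 L41 L34 L43 L44 algebra_simps power_numeral_reduce)
  have L42: "L (4, 2) = 7 * u ^ 8 - 8 * u ^ 7 + 2 * u ^ 6"
    by (subst rec) (simp add: sum_4_4 boxes_simps less_le_not_le L11 L13 L14 L12 L31 L33 L41 L34 L43 L32 L44 algebra_simps power_numeral_reduce)
  have L23: "L (2, 3) = 12 * u ^ 9 - 18 * u ^ 8 + 8 * u ^ 7 - u ^ 6"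
    by (subst rec) (simp add: sum_4_4 boxes_simps less_le_not_le L11 L13 L14 L12 L31 L33 L41 L34 L43 L32 L44 L21 L42 algebra_simps power_numeral_reduce)
  have L24: "L (2, 4) = 12 * u ^ 10 - 18 * u ^ 9 + 8 * u ^ 8 - u ^ 7"
    by (subst rec) (simp add: sum_4_4 boxes_simps less_le_not_le L11 L13 L14 L12 L31 L33 L41 L34 L43 L32 L44 L21 L42 L23 algebra_simps power_numeral_reduce)
  have L22: "L (2, 2) = 12 * u ^ 11 - 18 * u ^ 10 + 8 * u ^ 9 - u ^ 8"
    by (subst rec) (simp add: sum_4_4 boxes_simps less_le_not_le L11 L13 L14 L12 L31 L33 L41 L34 L43 L32 L44 L21 L42 L23 L24 algebra_simps power_numeral_reduce)
  show ?thesis by (rule L22)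
qed

theorem theorem3p6:
  shows "hilbert_series (zariski_closure (cone_set Sp4)) =
    (1 + 5 * fps_X + 5 * fps_X ^ 2 + fps_X ^ 3) / (1 - fps_X) ^ 11"
proof -
  define u :: "rat fps" where "u = inverse (1 - fps_X)"
  have u1: "u * (1 - fps_X) = 1"
    unfolding u_def by (rule inverse_mult_eq_1) simp
  \<comment> \<open>The entry at \<open>(2, 2)\<close> has the full diagram, so its series counts
    all chain monomials.\<close>
  have "boxes v \<subseteq> boxes (2, 2)" for v
    by (cases v rule: exhaust_4_4) (simp_all add: boxes_simps)
  then have "chain_monos boxes d = chain_monos_below boxes (2, 2) d" for d
    by (simp add: chain_monos_below_def)
  then have "hilbert_series (zariski_closure (cone_set Sp4)) = 12 * u ^ 11 - 18 * u ^ 10 + 8 * u ^ 9 - u ^ 8"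
    unfolding hilbert_series_def coord_ring_dim_cone u_def by (simp only: chain_series_top)
  also have "\<dots> = (1 + 5 * fps_X + 5 * fps_X ^ 2 + fps_X ^ 3) * u ^ 11"
  proof -
    \<comment> \<open>Pairing each power of \<open>fps_X\<close> with an equal power of
      \<open>u\<close> turns the numerator into a polynomial in \<open>u\<close>.\<close>
    have X: "fps_X * u = u - 1" using u1 by (simp add: algebra_simps)
    have "(1 + 5 * fps_X + 5 * fps_X ^ 2 + fps_X ^ 3) * u ^ 11 =
        u ^ 11 + 5 * (fps_X * u) * u ^ 10 + 5 * (fps_X * u) ^ 2 * u ^ 9 + (fps_X * u) ^ 3 * u ^ 8"
      by (simp add: power_numeral_reduce algebra_simps)
    also have "\<dots> = 12 * u ^ 11 - 18 * u ^ 10 + 8 * u ^ 9 - u ^ 8"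
      unfolding X by (simp add: power_numeral_reduce algebra_simps)
    finally show ?thesis by simp
  qed
  also have "\<dots> = (1 + 5 * fps_X + 5 * fps_X ^ 2 + fps_X ^ 3) / (1 - fps_X) ^ 11"
    by (simp add: u_def fps_divide_unit fps_inverse_power)
  finally show ?thesis .
qed

end
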